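(* Let $\varepsilon_1>0$. For every user $v_i$, the group randomized response step described in the context, run with parameter $\varepsilon_1$, has privacy budget $\varepsilon_1$: it is an $\varepsilon_1$-edge locally differentially private query to $v_i$.
   Context: Users $v_1,\dots,v_n$ are the nodes of a simple graph $G=(V,E)$; user $v_i$ holds the adjacency list $a_i=(a_{i,1},\dots,a_{i,n})\in\{0,1\}^n$ with $a_{i,j}=1$ iff $\{v_i,v_j\}\in E$. A randomized query $\mathcal R$ to $v_i$ is $\epsilon$-edge locally differentially private (has privacy budget $\epsilon$) if $\Pr[\mathcal R(a)\in S]\le e^{\epsilon}\Pr[\mathcal R(a')\in S]$ for all $a,a'\in\{0,1\}^n$ with $\ell_1$-distance at most $1$ and all sets $S$ of outcomes. Group randomized response step with integer sampling size $s\ge 1$. Let $p$ be the smallest prime larger than $n$, $m=\lceil p/s\rceil$, $\varepsilon'=\ln(1+s(e^{\varepsilon_1}-1))$. The server publishes $(\theta_i,\phi_i)$ drawn uniformly from $\{1,\dots,p-1\}\times\{0,\dots,p-1\}$ independently of the graph, defining $h_i(j)=((\theta_i j+\phi_i)\bmod p)\bmod m$. User $v_i$ forms the $m$ groups $S_{i,t}=\{v_j:h_i(j)=t\}$, each padded with dummy elements (non-neighbours of $v_i$) to size exactly $s$. From each group an element $v_{c_t}$ is drawn uniformly (probability $1/s$ each), independently over groups; the index $c_t$ is never published. The bit $a_{i,c_t}$ (replaced by $0$ if $c_t>i$ or if the element is a dummy) is passed through randomized response with budget $\varepsilon'$: the output bit $a'_{i,c_t}$ equals the input bit with probability $\frac{e^{\varepsilon'}}{1+e^{\varepsilon'}}$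 and its complement with probability $\frac{1}{1+e^{\varepsilon'}}$, independently over $t$. The query's output is the vector $(a'_{i,c_t})_t$ of $m$ bits (together with the public hash parameters). *)

theory Defs
  imports "HOL-Probability.Probability" "HOL-Number_Theory.Number_Theory"
begin

text \<open>The users are \<open>1, \<dots>, n\<close>. Bits are the integers 0 and 1, so that the subtraction in the
  distance below is not truncated.\<close>

definition adjacency_lists :: "nat \<Rightarrow> (nat \<Rightarrow> int) set" where
  "adjacency_lists n = {1..n} \<rightarrow>\<^sub>E {0, 1}"

definition l1_dist :: "nat \<Rightarrow> (nat \<Rightarrow> int) \<Rightarrow> (nat \<Rightarrow> int) \<Rightarrow> int" where
  "l1_dist n a a' = (\<Sum>j=1..n. \<bar>a j - a' j\<bar>)"

text \<open>A randomized query to a user is a function from the user's adjacency list to a distribution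
  of outcomes.\<close>

definition edge_ldp :: "nat \<Rightarrow> real \<Rightarrow> ((nat \<Rightarrow> int) \<Rightarrow> 'o pmf) \<Rightarrow> bool" where
  "edge_ldp n \<epsilon> R \<longleftrightarrow>
     (\<forall>a \<in> adjacency_lists n. \<forall>a' \<in> adjacency_lists n. l1_dist n a a' \<le> 1 \<longrightarrow>
        (\<forall>S. measure_pmf.prob (R a) S \<le> exp \<epsilon> * measure_pmf.prob (R a') S))"

definition randomized_response :: "real \<Rightarrow> int \<Rightarrow> int pmf" where
  "randomized_response \<epsilon> b =
     map_pmf (\<lambda>keep. if keep then b else 1 - b) (bernoulli_pmf (exp \<epsilon> / (1 + exp \<epsilon>)))"

definition hash_prime :: "nat \<Rightarrow> nat" where
  "hash_prime n = (LEAST p. prime p \<and> p > n)"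

definition num_groups :: "nat \<Rightarrow> nat \<Rightarrow> nat" where
  "num_groups n s = nat \<lceil>real (hash_prime n) / real s\<rceil>"

definition group_budget :: "nat \<Rightarrow> real \<Rightarrow> real" where
  "group_budget s \<epsilon>\<^sub>1 = ln (1 + real s * (exp \<epsilon>\<^sub>1 - 1))"

definition group_hash :: "nat \<Rightarrow> nat \<Rightarrow> nat \<times> nat \<Rightarrow> nat \<Rightarrow> nat" where
  "group_hash n s = (\<lambda>(\<theta>, \<phi>) j. ((\<theta> * j + \<phi>) mod hash_prime n) mod num_groups n s)"

definition user_group :: "nat \<Rightarrow> nat \<Rightarrow> nat \<times> nat \<Rightarrow> nat \<Rightarrow> nat set" where
  "user_group n s h t = {j \<in> {1..n}. group_hash n s h j = t}"

datatype group_element = User nat | Dummy nat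

definition padded_group :: "nat \<Rightarrow> nat \<Rightarrow> nat \<times> nat \<Rightarrow> nat \<Rightarrow> group_element set" where
  "padded_group n s h t =
     User ` user_group n s h t \<union> Dummy ` {..<s - card (user_group n s h t)}"

text \<open>User \<open>i\<close> answers only for the users up to \<open>i\<close>; dummies are non-neighbours.\<close>

fun masked_bit :: "nat \<Rightarrow> (nat \<Rightarrow> int) \<Rightarrow> group_element \<Rightarrow> int" where
  "masked_bit i a (User j) = (if j > i then 0 else a j)"
| "masked_bit i a (Dummy d) = 0"

definition group_response ::
    "nat \<Rightarrow> nat \<Rightarrow> real \<Rightarrow> nat \<Rightarrow> nat \<times> nat \<Rightarrow> (nat \<Rightarrow> int) \<Rightarrow> nat \<Rightarrow> int pmf" where
  "group_response n s \<epsilon>\<^sub>1 i h a t =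
     do {
       c \<leftarrow> pmf_of_set (padded_group n s h t);
       randomized_response (group_budget s \<epsilon>\<^sub>1) (masked_bit i a c)
     }"

text \<open>The outcome consists of the public hash parameters and the vector of the reported bits,
  indexed by the groups (and 0 outside this index range, by convention). The sampled elements are
  not part of it.\<close>

definition group_randomized_response ::
    "nat \<Rightarrow> nat \<Rightarrow> real \<Rightarrow> nat \<Rightarrow> (nat \<Rightarrow> int) \<Rightarrow> ((nat \<times> nat) \<times> (nat \<Rightarrow> int)) pmf" where
  "group_randomized_response n s \<epsilon>\<^sub>1 i a =
     do {
       h \<leftarrow> pmf_of_set ({1..hash_prime n - 1} \<times> {0..hash_prime n - 1});
       bits \<leftarrow> Pi_pmf {..<num_groups n s} 0 (group_response n s \<epsilon>\<^sub>1 i h a);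
       return_pmf (h, bits)
     }"

text \<open>The truncated subtraction in \<^const>\<open>padded_group\<close> is harmless: no group has more
  than \<open>s\<close> elements.\<close>

lemma hash_prime: "prime (hash_prime n)" "hash_prime n > n"
proof -
  have "\<exists>p. prime p \<and> p > n"
    using bigger_prime by blast
  then have "prime (hash_prime n) \<and> hash_prime n > n"
    unfolding hash_prime_def by (rule LeastI_ex)
  then show "prime (hash_prime n)" "hash_prime n > n"
    by auto
qed

lemma num_groups_mult_ge:
  assumes "s \<ge> 1"
  shows "hash_prime n \<le> s * num_groups n s"
proof -
  have "real (hash_prime n) / real s \<le> real (num_groups n s)"
    unfolding num_groups_def by linarith
  then have "real (hash_prime n) \<le> real (s * num_groups n s)"
    using assms by (simp add: field_simps)
  then show ?thesis
    by (simp only: of_nat_le_iff)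
qed

lemma card_user_group_le:
  assumes "s \<ge> 1" "\<theta> \<in> {1..hash_prime n - 1}"
  shows "card (user_group n s (\<theta>, \<phi>) t) \<le> s"
proof -
  define p m where "p = hash_prime n" and "m = num_groups n s"
  define r where "r = (\<lambda>j. (\<theta> * j + \<phi>) mod p)"
  have p: "prime p" "p > n"
    unfolding p_def by (rule hash_prime)+
  have pm: "p \<le> s * m"
    unfolding p_def m_def by (rule num_groups_mult_ge) fact
  have "\<not> p dvd \<theta>"
    using assms(2) p(1) prime_gt_0_nat[of p] unfolding p_def by (auto dest!: dvd_imp_le)
  then have cop: "coprime \<theta> p"
    using p(1) prime_imp_coprime coprime_commute by blast
  have "inj_on (\<lambda>j. r j div m) (user_group n s (\<theta>, \<phi>) t)"
  proof (rule inj_onI)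
    fix x y assume x: "x \<in> user_group n s (\<theta>, \<phi>) t" and y: "y \<in> user_group n s (\<theta>, \<phi>) t"
      and eq: "r x div m = r y div m"
    have "r x mod m = r y mod m"
      using x y by (simp add: user_group_def group_hash_def r_def p_def m_def)
    with eq have "r x = r y"
      by (metis div_mult_mod_eq)
    then have "[\<theta> * x = \<theta> * y] (mod p)"
      unfolding r_def cong_def[symmetric] by (simp add: cong_add_rcancel_nat)
    then have "[x = y] (mod p)"
      using cop by (simp add: cong_mult_lcancel_nat)
    moreover have "x < p" "y < p"
      using x y p(2) by (auto simp: user_group_def)
    ultimately show "x = y"
      by (simp add: cong_def)
  qed
  moreover have "(\<lambda>j. r j div m) ` user_group n s (\<theta>, \<phi>) t \<subseteq> {..<s}"
  proof clarsimp
    fix j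
    have "r j < p"
      unfolding r_def using p(1) prime_gt_0_nat by simp
    then show "r j div m < s"
      using pm by (simp add: less_mult_imp_div_less)
  qed
  ultimately have "card (user_group n s (\<theta>, \<phi>) t) \<le> card {..<s}"
    by (intro card_inj_on_le) auto
  then show ?thesis
    by simp
qed

lemma card_padded_group:
  assumes "s \<ge> 1" "\<theta> \<in> {1..hash_prime n - 1}"
  shows "card (padded_group n s (\<theta>, \<phi>) t) = s"
proof -
  have "finite (user_group n s (\<theta>, \<phi>) t)"
    by (simp add: user_group_def)
  then have "card (padded_group n s (\<theta>, \<phi>) t) =
      card (user_group n s (\<theta>, \<phi>) t) + (s - card (user_group n s (\<theta>, \<phi>) t))"
    unfolding padded_group_def
    by (subst card_Un_disjoint) (auto simp: card_image inj_on_def)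
  with card_user_group_le[OF assms, of \<phi> t] show ?thesis
    by simp
qed

end

theory Submission
  imports Defs
begin

text \<open>Neighbouring adjacency lists differ at one user \<open>j\<close>, so for fixed hash parameters
  only the bit reported by the group of \<open>j\<close> has a different distribution. Up to the factor
  \<open>1 / s\<close>, the probability of either value of this bit is a sum over the \<open>s\<close> elements of the group
  whose terms lie in \<open>[L, (1 + s x) L]\<close>, where \<open>L = 1 / (1 + exp \<epsilon>')\<close> and
  \<open>x = exp \<epsilon>\<^sub>1 - 1\<close>. Changing one term multiplies such a sum by at most \<open>1 + x\<close>.\<close>

text \<open>Reduces privacy to a pointwise comparison of masses. Summation over an arbitrary
  \<open>S\<close> is legitimate because masses are absolutely summable on every set.\<close>

lemma prob_le_of_pmf_le:
  assumes "\<And>x. pmf P x \<le> c * pmf Q x"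
  shows "measure_pmf.prob P S \<le> c * measure_pmf.prob Q S"
proof -
  have "infsetsum (pmf P) S \<le> infsetsum (\<lambda>x. c * pmf Q x) S"
    by (intro infsetsum_mono pmf_abs_summable abs_summable_on_cmult_right assms)
  then show ?thesis
    by (simp add: measure_pmf_conv_infsetsum infsetsum_cmult_right pmf_abs_summable)
qed

text \<open>A mixture inherits a bound that holds for each component. The restriction to the support
  of \<open>M\<close> matters: for the hash parameters it supplies \<theta> \<ge> 1, on which the
  group sizes depend.\<close>

lemma pmf_bind_pmf_le:
  assumes "\<And>h. h \<in> set_pmf M \<Longrightarrow> pmf (f h) y \<le> c * pmf (g h) y"
  shows "pmf (bind_pmf M f) y \<le> c * pmf (bind_pmf M g) y"
proof -
  have int: "integrable (measure_pmf M) (\<lambda>h. pmf (k h) y)" for k :: "'a \<Rightarrow> 'b pmf"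
    by (rule measure_pmf.integrable_const_bound[where B = 1]) (auto simp: pmf_le_1)
  have "(\<integral>h. pmf (f h) y \<partial>measure_pmf M) \<le> (\<integral>h. c * pmf (g h) y \<partial>measure_pmf M)"
    by (intro integral_mono_AE int integrable_mult_right) (auto simp: AE_measure_pmf_iff assms)
  then show ?thesis
    by (simp add: pmf_bind)
qed

text \<open>Since the hash parameters are published, an outcome can arise only from its own first
  component.\<close>

lemma pmf_bind_return_Pair:
  "pmf (P \<bind> (\<lambda>b. return_pmf (h, b))) out = (if fst out = h then pmf P (snd out) else 0)"
proof (cases "fst out = h")
  case True
  then have "out = Pair h (snd out)"
    by auto
  then show ?thesis
    using pmf_map_inj'[of "Pair h" P "snd out"] True by (simp add: inj_on_def map_pmf_def)
next
  case False
  then have "out \<notin> set_pmf (P \<bind> (\<lambda>b. return_pmf (h, b)))"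
    by auto
  then show ?thesis
    using False unfolding set_pmf_iff by (simp only: if_False not_not)
qed

text \<open>By independence the mass is a product, and only the factor at \<open>u\<close> changes.
  If \<open>u\<close> lies outside \<open>A\<close>, the products agree and \<open>c \<ge> 1\<close>
  suffices; thus a hash value can be taken as \<open>u\<close> without checking that it is a group
  index.\<close>

lemma pmf_Pi_le_if_differ_at_one:
  assumes "finite A" and "c \<ge> 1"
    and le: "\<And>y. u \<in> A \<Longrightarrow> pmf (P u) y \<le> c * pmf (Q u) y"
    and eq: "\<And>t. t \<in> A \<Longrightarrow> t \<noteq> u \<Longrightarrow> P t = Q t"
  shows "pmf (Pi_pmf A d P) f \<le> c * pmf (Pi_pmf A d Q) f"
proof (cases "\<forall>t. t \<notin> A \<longrightarrow> f t = d")
  case True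
  have prod: "(\<Prod>t\<in>A. pmf (P t) (f t)) \<le> c * (\<Prod>t\<in>A. pmf (Q t) (f t))"
  proof (cases "u \<in> A")
    case True
    have "(\<Prod>t\<in>A - {u}. pmf (P t) (f t)) = (\<Prod>t\<in>A - {u}. pmf (Q t) (f t))"
      using eq by (intro prod.cong) auto
    moreover have "pmf (P u) (f u) * (\<Prod>t\<in>A - {u}. pmf (Q t) (f t)) \<le>
        c * pmf (Q u) (f u) * (\<Prod>t\<in>A - {u}. pmf (Q t) (f t))"
      using le[OF True] by (intro mult_right_mono prod_nonneg) auto
    ultimately show ?thesis
      using assms(1) True by (simp add: prod.remove mult.assoc)
  next
    case False
    then have "P t = Q t" if "t \<in> A" for t
      using eq that by blast
    then have "(\<Prod>t\<in>A. pmf (P t) (f t)) = (\<Prod>t\<in>A. pmf (Q t) (f t))"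
      by simp
    then show ?thesis
      using mult_right_mono[OF \<open>c \<ge> 1\<close>, of "\<Prod>t\<in>A. pmf (Q t) (f t)"]
      by (simp add: prod_nonneg)
  qed
  show ?thesis
    using prod True \<open>finite A\<close> by (simp add: pmf_Pi)
next
  \<comment> \<open>Such an \<open>f\<close> deviates from the default \<open>d\<close> outside
    \<open>A\<close> and has mass 0 on both sides.\<close>
  case False
  then show ?thesis
    unfolding pmf_Pi[OF \<open>finite A\<close>] by (simp only: if_False)
qed

text \<open>Since \<open>g z\<close> is at least \<open>L\<close>, the increase
  \<open>f z - g z\<close> is at most \<open>x * card G * L\<close>. As every term of
  \<open>g\<close> is at least \<open>L\<close>, this is at most \<open>x\<close> times the sum of
  \<open>g\<close>.\<close>

lemma sum_le_mult_sum_if_differ_at_one: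
  fixes f g :: "'a \<Rightarrow> real"
  assumes "finite G" and "x \<ge> 0" and "z \<in> G"
    and eq: "\<And>c. c \<in> G \<Longrightarrow> c \<noteq> z \<Longrightarrow> f c = g c"
    and lower: "\<And>c. c \<in> G \<Longrightarrow> L \<le> g c"
    and upper: "f z \<le> L * (1 + real (card G) * x)"
  shows "sum f G \<le> (1 + x) * sum g G"
proof -
  define W where "W = sum g (G - {z})"
  have f: "sum f G = f z + W"
    using eq by (simp add: W_def sum.remove[OF assms(1,3)])
  have g: "sum g G = g z + W"
    using assms(1,3) by (simp add: W_def sum.remove)
  have card: "real (card G) = 1 + real (card (G - {z}))"
    using card.remove[OF assms(1,3)] by simp
  have "real (card (G - {z})) * L \<le> W"
    unfolding W_def using lower by (intro sum_bounded_below) auto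
  then have "real (card G) * L \<le> g z + W"
    using lower[OF assms(3)] by (simp add: card algebra_simps)
  then have "x * (real (card G) * L) \<le> x * (g z + W)"
    using assms(2) by (rule mult_left_mono)
  moreover have "f z \<le> L + x * (real (card G) * L)"
    using upper by (simp add: algebra_simps)
  ultimately show ?thesis
    using lower[OF assms(3)] unfolding f g by (simp add: algebra_simps)
qed

lemma pmf_randomized_response:
  assumes "b \<in> {0, 1}"
  shows "pmf (randomized_response \<epsilon> b) y =
    (if y = b then exp \<epsilon> / (1 + exp \<epsilon>) else if y = 1 - b then 1 / (1 + exp \<epsilon>) else 0)"
proof -
  have q: "exp \<epsilon> / (1 + exp \<epsilon>) \<in> {0..1}"
    by (auto simp: divide_simps add_pos_pos)
  have "1 + exp \<epsilon> \<noteq> 0"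
    using exp_gt_zero[of \<epsilon>] by linarith
  then have compl: "1 - exp \<epsilon> / (1 + exp \<epsilon>) = 1 / (1 + exp \<epsilon>)"
    by (simp add: field_simps)
  have "pmf (randomized_response \<epsilon> b) y =
      (if b = y then exp \<epsilon> / (1 + exp \<epsilon>) else 0) +
      (if 1 - b = y then 1 - exp \<epsilon> / (1 + exp \<epsilon>) else 0)"
    using q unfolding randomized_response_def map_pmf_def
    by (simp add: pmf_bind integral_bernoulli_pmf pmf_return indicator_def)
  then show ?thesis
    using assms unfolding compl by auto
qed

lemma exp_group_budget:
  assumes "\<epsilon>\<^sub>1 \<ge> 0"
  shows "exp (group_budget s \<epsilon>\<^sub>1) = 1 + real s * (exp \<epsilon>\<^sub>1 - 1)"
proof -
  have "0 \<le> real s * (exp \<epsilon>\<^sub>1 - 1)"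
    using assms by simp
  then show ?thesis
    by (simp add: group_budget_def)
qed

text \<open>The uniform weights \<open>1 / card G\<close> cancel, leaving sums over
  \<open>G\<close>. With the budget formed from \<open>card G\<close>, the ratio
  \<open>exp \<epsilon>'\<close> of the two response probabilities is exactly what the bound for
  sums allows.\<close>

lemma pmf_sampled_response_le:
  assumes "\<epsilon>\<^sub>1 \<ge> 0" and "finite G" and "z \<in> G"
    and bits: "\<And>c. c \<in> G \<Longrightarrow> b c \<in> {0, 1}" "\<And>c. c \<in> G \<Longrightarrow> b' c \<in> {0, 1}"
    and eq: "\<And>c. c \<in> G \<Longrightarrow> c \<noteq> z \<Longrightarrow> b c = b' c"
  defines "\<epsilon>' \<equiv> group_budget (card G) \<epsilon>\<^sub>1"
  shows "pmf (pmf_of_set G \<bind> (\<lambda>c. randomized_response \<epsilon>' (b c))) y \<le>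
    exp \<epsilon>\<^sub>1 * pmf (pmf_of_set G \<bind> (\<lambda>c. randomized_response \<epsilon>' (b' c))) y"
proof -
  define r where "r = (\<lambda>b. pmf (randomized_response \<epsilon>' b) y)"
  have e: "exp \<epsilon>' = 1 + real (card G) * (exp \<epsilon>\<^sub>1 - 1)"
    unfolding \<epsilon>'_def using assms(1) by (rule exp_group_budget)
  have "G \<noteq> {}"
    using assms(3) by auto
  have "(\<Sum>c\<in>G. r (b c)) \<le> exp \<epsilon>\<^sub>1 * (\<Sum>c\<in>G. r (b' c))"
  proof (cases "y \<in> {0, 1}")
    case True
    define L where "L = 1 / (1 + exp \<epsilon>')"
    have "exp \<epsilon>' \<ge> 1"
      using assms(1) by (simp add: e)
    then have L: "L \<le> L * exp \<epsilon>'"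
      by (simp add: L_def divide_right_mono)
    have "r v = L * exp \<epsilon>' \<or> r v = L" if "v \<in> {0, 1}" for v
      using True that unfolding r_def L_def pmf_randomized_response[OF that] by auto
    then have r: "L \<le> r v \<and> r v \<le> L * exp \<epsilon>'" if "v \<in> {0, 1}" for v
      using L that by fastforce
    have "(\<Sum>c\<in>G. r (b c)) \<le> (1 + (exp \<epsilon>\<^sub>1 - 1)) * (\<Sum>c\<in>G. r (b' c))"
    proof (rule sum_le_mult_sum_if_differ_at_one[where z = z and L = L])
      show "r (b z) \<le> L * (1 + real (card G) * (exp \<epsilon>\<^sub>1 - 1))"
        using r bits(1) assms(3) unfolding e[symmetric] by blast
      show "r (b c) = r (b' c)" if "c \<in> G" "c \<noteq> z" for c
        using eq that by simp
      show "L \<le> r (b' c)" if "c \<in> G" for c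
        using r bits(2) that by blast
    qed (use assms(1-3) in auto)
    then show ?thesis
      by simp
  next
    \<comment> \<open>Reports are integers; a value that is not a bit has mass 0 on both
      sides.\<close>
    case False
    then have "r v = 0" if "v \<in> {0, 1}" for v
      using that unfolding r_def pmf_randomized_response[OF that] by auto
    then show ?thesis
      using bits by simp
  qed
  then have "(\<Sum>c\<in>G. r (b c)) / card G \<le> exp \<epsilon>\<^sub>1 * ((\<Sum>c\<in>G. r (b' c)) / card G)"
    using divide_right_mono by fastforce
  then show ?thesis
    using assms(2) \<open>G \<noteq> {}\<close> by (simp add: pmf_bind integral_pmf_of_set r_def)
qed

text \<open>Entries are integers, so two positions of disagreement would already give distance at
  least 2. For equal lists any \<open>j\<close> serves.\<close>

lemma adjacency_lists_differ_at_one: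
  assumes "a \<in> adjacency_lists n" and "a' \<in> adjacency_lists n" and "l1_dist n a a' \<le> 1"
  obtains j where "\<And>k. k \<noteq> j \<Longrightarrow> a k = a' k"
proof (cases "\<exists>j. a j \<noteq> a' j")
  case True
  then obtain j where j: "a j \<noteq> a' j"
    by blast
  \<comment> \<open>Outside \<open>{1..n}\<close> both lists are \<open>undefined\<close>, so
    \<open>l1_dist\<close> sees every disagreement.\<close>
  have mem: "k \<in> {1..n}" if "a k \<noteq> a' k" for k
    using assms(1,2) that unfolding adjacency_lists_def by (metis PiE_arb)
  have "a k = a' k" if "k \<noteq> j" for k
  proof (rule ccontr)
    assume k: "a k \<noteq> a' k"
    have "(\<Sum>l\<in>{j, k}. \<bar>a l - a' l\<bar>) \<le> l1_dist n a a'"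
      unfolding l1_dist_def using mem j k by (intro sum_mono2) auto
    then show False
      using assms(3) j k that by simp
  qed
  then show thesis
    by (rule that)
next
  case False
  then show thesis
    using that by blast
qed

lemma masked_bit_in_bits:
  assumes "a \<in> adjacency_lists n" and "c \<in> padded_group n s h t"
  shows "masked_bit i a c \<in> {0, 1}"
proof (cases c)
  case (User j)
  with assms(2) have "j \<in> {1..n}"
    by (auto simp: padded_group_def user_group_def)
  with assms(1) have "a j \<in> {0, 1}"
    unfolding adjacency_lists_def by (rule PiE_mem)
  then show ?thesis
    using User by simp
qed simp

lemma masked_bit_cong:
  assumes "\<And>k. k \<noteq> j \<Longrightarrow> a k = a' k" and "c \<noteq> User j"
  shows "masked_bit i a c = masked_bit i a' c"
  using assms by (cases c) auto

lemma finite_padded_group: "finite (padded_group n s h t)"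
  by (simp add: padded_group_def user_group_def)

lemma group_response_cong:
  assumes "s \<ge> 1" and "\<theta> \<in> {1..hash_prime n - 1}"
    and "\<And>k. k \<noteq> j \<Longrightarrow> a k = a' k"
    and "User j \<notin> padded_group n s (\<theta>, \<phi>) t"
  shows "group_response n s \<epsilon>\<^sub>1 i (\<theta>, \<phi>) a t = group_response n s \<epsilon>\<^sub>1 i (\<theta>, \<phi>) a' t"
proof -
  \<comment> \<open>Nonemptiness is what identifies the support of \<open>pmf_of_set\<close> with
    the group.\<close>
  have "padded_group n s (\<theta>, \<phi>) t \<noteq> {}"
    using card_padded_group[OF assms(1,2), of \<phi> t] assms(1) by auto
  then have "c \<noteq> User j" if "c \<in> set_pmf (pmf_of_set (padded_group n s (\<theta>, \<phi>) t))" for c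
    using that assms(4) finite_padded_group by auto
  then show ?thesis
    unfolding group_response_def
    by (intro bind_pmf_cong refl arg_cong[where f = "randomized_response _"]
        masked_bit_cong[where j = j] assms(3))
qed

lemma pmf_group_response_le:
  assumes "\<epsilon>\<^sub>1 \<ge> 0" and "s \<ge> 1" and "\<theta> \<in> {1..hash_prime n - 1}"
    and "a \<in> adjacency_lists n" and "a' \<in> adjacency_lists n"
    and "\<And>k. k \<noteq> j \<Longrightarrow> a k = a' k"
  shows "pmf (group_response n s \<epsilon>\<^sub>1 i (\<theta>, \<phi>) a t) y \<le>
    exp \<epsilon>\<^sub>1 * pmf (group_response n s \<epsilon>\<^sub>1 i (\<theta>, \<phi>) a' t) y"
proof (cases "User j \<in> padded_group n s (\<theta>, \<phi>) t")
  case True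
  show ?thesis
    unfolding group_response_def
    \<comment> \<open>Padding to size exactly \<open>s\<close> turns the budget formed from
      \<open>card G\<close> into the prescribed one.\<close>
    by (rule pmf_sampled_response_le[OF assms(1) finite_padded_group True,
          unfolded card_padded_group[OF assms(2,3)]])
      (use masked_bit_in_bits assms(4-6) in \<open>blast intro: masked_bit_cong[where j = j]\<close>)+
next
  case False
  then have "group_response n s \<epsilon>\<^sub>1 i (\<theta>, \<phi>) a t =
      group_response n s \<epsilon>\<^sub>1 i (\<theta>, \<phi>) a' t"
    using assms(6) by (intro group_response_cong assms(2,3))
  then show ?thesis
    using assms(1) by (simp add: mult_le_cancel_right1)
qed

theorem lemma2:
  fixes n s i :: nat and \<epsilon>\<^sub>1 :: real
  assumes "\<epsilon>\<^sub>1 > 0" and "s \<ge> 1" and "i \<in> {1..n}"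
  shows "edge_ldp n \<epsilon>\<^sub>1 (group_randomized_response n s \<epsilon>\<^sub>1 i)"
  unfolding edge_ldp_def
proof (intro ballI impI allI prob_le_of_pmf_le)
  fix a a' out
  assume a: "a \<in> adjacency_lists n" "a' \<in> adjacency_lists n" and "l1_dist n a a' \<le> 1"
  then obtain j where j: "\<And>k. k \<noteq> j \<Longrightarrow> a k = a' k"
    using adjacency_lists_differ_at_one by blast
  let ?H = "{1..hash_prime n - 1} \<times> {0..hash_prime n - 1}"
  \<comment> \<open>This makes the range of \<theta> nonempty, so the support of the hash parameters
    is \<open>?H\<close>.\<close>
  have "hash_prime n \<ge> 2"
    using hash_prime(1) by (rule prime_ge_2_nat)
  then have H: "set_pmf (pmf_of_set ?H) = ?H"
    by (intro set_pmf_of_set) auto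
  have bits: "pmf (Pi_pmf {..<num_groups n s} 0 (group_response n s \<epsilon>\<^sub>1 i h a)) f \<le>
      exp \<epsilon>\<^sub>1 * pmf (Pi_pmf {..<num_groups n s} 0 (group_response n s \<epsilon>\<^sub>1 i h a')) f"
    if h_mem: "h \<in> ?H" for h f
  \<comment> \<open>User \<open>j\<close> can belong only to the group named by its hash value, so
    all other coordinates keep their distribution.\<close>
  proof (rule pmf_Pi_le_if_differ_at_one[where u = "group_hash n s h j"])
    obtain \<theta> \<phi> where h: "h = (\<theta>, \<phi>)" and \<theta>: "\<theta> \<in> {1..hash_prime n - 1}"
      using h_mem by auto
    show "pmf (group_response n s \<epsilon>\<^sub>1 i h a (group_hash n s h j)) y \<le>
        exp \<epsilon>\<^sub>1 * pmf (group_response n s \<epsilon>\<^sub>1 i h a' (group_hash n s h j)) y" for y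
      unfolding h using assms(1) by (intro pmf_group_response_le assms(2) \<theta> a j) auto
    fix t assume "t \<noteq> group_hash n s h j"
    then have "User j \<notin> padded_group n s h t"
      by (auto simp: padded_group_def user_group_def)
    then show "group_response n s \<epsilon>\<^sub>1 i h a t = group_response n s \<epsilon>\<^sub>1 i h a' t"
      unfolding h by (intro group_response_cong assms(2) \<theta> j)
  qed (use assms(1) in auto)
  show "pmf (group_randomized_response n s \<epsilon>\<^sub>1 i a) out \<le>
      exp \<epsilon>\<^sub>1 * pmf (group_randomized_response n s \<epsilon>\<^sub>1 i a') out"
    unfolding group_randomized_response_def
  \<comment> \<open>Both queries draw \<open>h\<close> from the same distribution, so it is enough
    to compare the bit vectors for each fixed \<open>h\<close>.\<close>
  proof (rule pmf_bind_pmf_le, unfold H pmf_bind_return_Pair)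
    fix h assume "h \<in> ?H"
    from bits[OF this, of "snd out"]
    show "(if fst out = h
          then pmf (Pi_pmf {..<num_groups n s} 0 (group_response n s \<epsilon>\<^sub>1 i h a)) (snd out) else 0) \<le>
        exp \<epsilon>\<^sub>1 * (if fst out = h
          then pmf (Pi_pmf {..<num_groups n s} 0 (group_response n s \<epsilon>\<^sub>1 i h a')) (snd out) else 0)"
      by simp
  qed
qed

end
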